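(* Let $\mathfrak{g}=A_{4,1}\oplus A_1$ and let $\langle\cdot,\cdot\rangle$ be an inner product on $\mathfrak{g}$. Let $\eta>0$ and let $\{v_1,\dots,v_5\}$ be a basis of $\mathfrak{g}$, orthonormal with respect to $\eta\langle\cdot,\cdot\rangle$, whose only nonzero brackets (up to antisymmetry) are either (first case) $[v_1,v_2]=\alpha v_3+\gamma v_5$, $[v_1,v_3]=\beta v_5$, or (second case) $[v_1,v_2]=\alpha v_3+\gamma v_4$, $[v_1,v_3]=\beta v_5$, where in both cases $\alpha,\beta>0$ and $\gamma\in\mathbb{R}$. Then, in either case, $\langle\cdot,\cdot\rangle$ is a Schouten like metric if and only if $\gamma=0$ and $\alpha=\beta$.
   Context: $A_{4,1}\oplus A_1$ is the five-dimensional real nilpotent Lie algebra having a basis with the brackets displayed in the claim (both forms describe the same Lie algebra up to isomorphism). An inner product on $\mathfrak{g}$ is identified with the left-invariant Riemannian metric $g$ it induces on the simply connected Lie group $G$ with Lie algebra $\mathfrak{g}$. Let $ric_g$ be the Ricci curvature tensor of $(G,g)$ (Levi-Civita connection), viewed as a symmetric bilinear form on $\mathfrak{g}$; since $\mathfrak{g}$ is nilpotent, $ric_g(u,v)=-\frac12\mathrm{tr}(ad_u\circ ad_v^* )-\frac14\mathrm{tr}(J_u\circ J_v)$, where $ad_uv=[u,v]$, $ad_v^*$ is the $g$-transpose of $ad_v$, and $J_uv=ad_v^*u$. The Ricci operator $Ric_g$ is defined by $ric_g(u,v)=g(Ric_g(u),v)$ and $s=\mathrm{tr}(Ric_g)$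 is the scalar curvature. A derivation $D$ of $\mathfrak{g}$ is symmetric with respect to $g$ if $g(Du,v)=g(u,Dv)$ for all $u,v$. The metric $g$ is a Schouten like metric if there are real numbers $\lambda_0,c$ and a derivation $D$ of $\mathfrak{g}$, symmetric with respect to $g$, such that $ric_g(X,Y)=(s\lambda_0+c)g(X,Y)+g(D(X),Y)$ for all $X,Y\in\mathfrak{g}$. *)

theory Defs
  imports "HOL-Analysis.Analysis"
begin

(* Brackets and metrics are explicit arguments. The class euclidean_space only supplies
   finite-dimensional real vector spaces; its canonical inner product is unrelated to the
   metric g and is used solely to write down traces. *)

definition real_lie_algebra :: "('a::real_vector \<Rightarrow> 'a \<Rightarrow> 'a) \<Rightarrow> bool" where
  "real_lie_algebra br \<longleftrightarrow> bilinear br \<and> (\<forall>x. br x x = 0) \<and>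
     (\<forall>x y z. br x (br y z) + br y (br z x) + br z (br x y) = 0)"

definition lie_isomorphic ::
  "('a::real_vector \<Rightarrow> 'a \<Rightarrow> 'a) \<Rightarrow> ('b::real_vector \<Rightarrow> 'b \<Rightarrow> 'b) \<Rightarrow> bool" where
  "lie_isomorphic br br' \<longleftrightarrow>
     (\<exists>f. linear f \<and> bij f \<and> (\<forall>x y. f (br x y) = br' (f x) (f y)))"

definition lie_direct_sum ::
  "('a \<Rightarrow> 'a \<Rightarrow> 'a) \<Rightarrow> ('b \<Rightarrow> 'b \<Rightarrow> 'b) \<Rightarrow> 'a \<times> 'b \<Rightarrow> 'a \<times> 'b \<Rightarrow> 'a \<times> 'b" where
  "lie_direct_sum br br' x y = (br (fst x) (fst y), br' (snd x) (snd y))"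

(* The nonzero brackets of the standard basis are [e1,e2] = e3 and [e1,e3] = e4. *)
definition A41 :: "real^4 \<Rightarrow> real^4 \<Rightarrow> real^4" where
  "A41 x y = (x$1 * y$2 - x$2 * y$1) *\<^sub>R axis 3 1 + (x$1 * y$3 - x$3 * y$1) *\<^sub>R axis 4 1"

definition A1 :: "real \<Rightarrow> real \<Rightarrow> real" where
  "A1 x y = 0"

definition inner_product :: "('a::real_vector \<Rightarrow> 'a \<Rightarrow> real) \<Rightarrow> bool" where
  "inner_product g \<longleftrightarrow>
     bilinear g \<and> (\<forall>x y. g x y = g y x) \<and> (\<forall>x. x \<noteq> 0 \<longrightarrow> g x x > 0)"

definition derivation :: "('a::real_vector \<Rightarrow> 'a \<Rightarrow> 'a) \<Rightarrow> ('a \<Rightarrow> 'a) \<Rightarrow> bool" where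
  "derivation br D \<longleftrightarrow> linear D \<and> (\<forall>x y. D (br x y) = br (D x) y + br x (D y))"

definition symmetric_wrt :: "('a \<Rightarrow> 'a \<Rightarrow> real) \<Rightarrow> ('a \<Rightarrow> 'a) \<Rightarrow> bool" where
  "symmetric_wrt g D \<longleftrightarrow> (\<forall>u v. g (D u) v = g u (D v))"

definition lin_trace :: "('a::euclidean_space \<Rightarrow> 'a) \<Rightarrow> real" where
  "lin_trace f = (\<Sum>b\<in>Basis. f b \<bullet> b)"

(* The Levi-Civita connection on left-invariant fields: for these the Koszul formula has no
   derivative terms, since the functions g x y are constant on the group. *)
definition levi_civita ::
  "('a \<Rightarrow> 'a \<Rightarrow> 'a) \<Rightarrow> ('a \<Rightarrow> 'a \<Rightarrow> real) \<Rightarrow> 'a \<Rightarrow> 'a \<Rightarrow> 'a" where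
  "levi_civita br g u v =
     (THE x. \<forall>w. 2 * g x w = g (br u v) w - g (br v w) u + g (br w u) v)"

definition curvature ::
  "('a::real_vector \<Rightarrow> 'a \<Rightarrow> 'a) \<Rightarrow> ('a \<Rightarrow> 'a \<Rightarrow> real) \<Rightarrow> 'a \<Rightarrow> 'a \<Rightarrow> 'a \<Rightarrow> 'a" where
  "curvature br g u v w =
     levi_civita br g u (levi_civita br g v w) - levi_civita br g v (levi_civita br g u w)
       - levi_civita br g (br u v) w"

definition ricci ::
  "('a::euclidean_space \<Rightarrow> 'a \<Rightarrow> 'a) \<Rightarrow> ('a \<Rightarrow> 'a \<Rightarrow> real) \<Rightarrow> 'a \<Rightarrow> 'a \<Rightarrow> real" where
  "ricci br g u v = lin_trace (\<lambda>w. curvature br g w u v)"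

definition ricci_operator ::
  "('a::euclidean_space \<Rightarrow> 'a \<Rightarrow> 'a) \<Rightarrow> ('a \<Rightarrow> 'a \<Rightarrow> real) \<Rightarrow> 'a \<Rightarrow> 'a" where
  "ricci_operator br g u = (THE w. \<forall>v. ricci br g u v = g w v)"

definition scalar_curvature ::
  "('a::euclidean_space \<Rightarrow> 'a \<Rightarrow> 'a) \<Rightarrow> ('a \<Rightarrow> 'a \<Rightarrow> real) \<Rightarrow> real" where
  "scalar_curvature br g = lin_trace (ricci_operator br g)"

definition schouten_like ::
  "('a::euclidean_space \<Rightarrow> 'a \<Rightarrow> 'a) \<Rightarrow> ('a \<Rightarrow> 'a \<Rightarrow> real) \<Rightarrow> bool" where
  "schouten_like br g \<longleftrightarrow>
     (\<exists>l0 c D. derivation br D \<and> symmetric_wrt g D \<and>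
       (\<forall>x y. ricci br g x y = (scalar_curvature br g * l0 + c) * g x y + g (D x) y))"

(* A basis indexed by {1..n}, orthonormal with respect to the metric h. *)
definition orthonormal_basis ::
  "('a::real_vector \<Rightarrow> 'a \<Rightarrow> real) \<Rightarrow> nat \<Rightarrow> (nat \<Rightarrow> 'a) \<Rightarrow> bool" where
  "orthonormal_basis h n v \<longleftrightarrow>
     inj_on v {1..n} \<and> independent (v ` {1..n}) \<and> span (v ` {1..n}) = UNIV \<and>
     (\<forall>i\<in>{1..n}. \<forall>j\<in>{1..n}. h (v i) (v j) = (if i = j then 1 else 0))"

(* Among [v_i, v_j] with i < j, at most those listed in P can be nonzero. *)
definition only_nonzero_brackets ::
  "('a::zero \<Rightarrow> 'a \<Rightarrow> 'a) \<Rightarrow> nat \<Rightarrow> (nat \<Rightarrow> 'a) \<Rightarrow> (nat \<times> nat) set \<Rightarrow> bool" where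
  "only_nonzero_brackets br n v P \<longleftrightarrow>
     (\<forall>i\<in>{1..n}. \<forall>j\<in>{1..n}. i < j \<longrightarrow> (i, j) \<notin> P \<longrightarrow> br (v i) (v j) = 0)"

(* The rest of this theory checks the curvature convention: for a nilpotent Lie algebra, ricci is
   the usual expression -1/2 tr(ad_u ad_v^* ) - 1/4 tr(J_u J_v) with J_u v = ad_v^* u. *)

definition nilpotent_lie :: "('a::zero \<Rightarrow> 'a \<Rightarrow> 'a) \<Rightarrow> bool" where
  "nilpotent_lie br \<longleftrightarrow> (\<exists>k. \<forall>xs y. length xs = k \<longrightarrow> foldr br xs y = 0)"

definition adjoint_wrt :: "('a \<Rightarrow> 'a \<Rightarrow> real) \<Rightarrow> ('a \<Rightarrow> 'a) \<Rightarrow> 'a \<Rightarrow> 'a" where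
  "adjoint_wrt g f = (SOME f'. \<forall>x y. g (f x) y = g x (f' y))"

definition J_map :: "('a \<Rightarrow> 'a \<Rightarrow> 'a) \<Rightarrow> ('a \<Rightarrow> 'a \<Rightarrow> real) \<Rightarrow> 'a \<Rightarrow> 'a \<Rightarrow> 'a" where
  "J_map br g u v = adjoint_wrt g (br v) u"

lemma lin_trace_comp_commute:
  fixes f h :: "'a::euclidean_space \<Rightarrow> 'a"
  assumes f: "linear f" and h: "linear h"
  shows "lin_trace (\<lambda>x. f (h x)) = lin_trace (\<lambda>x. h (f x))"
proof -
  have expand: "p (q b) \<bullet> b = (\<Sum>c\<in>Basis. (q b \<bullet> c) * (p c \<bullet> b))"
    if p: "linear p" for p q :: "'a \<Rightarrow> 'a" and b
  proof -
    have "p (q b) = p (\<Sum>c\<in>Basis. (q b \<bullet> c) *\<^sub>R c)"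
      by (simp add: euclidean_representation)
    also have "\<dots> = (\<Sum>c\<in>Basis. (q b \<bullet> c) *\<^sub>R p c)"
      by (simp add: linear_sum[OF p] linear_cmul[OF p])
    finally show ?thesis by (simp add: inner_sum_left)
  qed
  show ?thesis
    unfolding lin_trace_def by (subst expand[OF f], subst expand[OF h], subst sum.swap) (simp add: mult.commute)
qed

lemma lin_trace_simps:
  "lin_trace (\<lambda>x. f x + h x) = lin_trace f + lin_trace h"
  "lin_trace (\<lambda>x. f x - h x) = lin_trace f - lin_trace h"
  "lin_trace (\<lambda>x. - f x) = - lin_trace f"
  "lin_trace (\<lambda>x. c *\<^sub>R f x) = c * lin_trace f"
  by (simp_all add: lin_trace_def inner_add_left inner_diff_left sum.distrib sum_subtractf
      sum_negf sum_distrib_left)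

lemma lin_trace_nilpotent:
  fixes f :: "'a::euclidean_space \<Rightarrow> 'a"
  assumes "linear f" "\<And>x. (f ^^ Suc k) x = 0"
  shows "lin_trace f = 0"
  using assms
proof (induction k arbitrary: f)
  case 0
  then show ?case by (simp add: lin_trace_def)
next
  case (Suc k)
  obtain B where B: "independent B" "B \<subseteq> range f" "range f \<subseteq> span B"
    using basis_exists by metis
  obtain P where P: "linear P" "\<forall>x\<in>B. P x = x" "range P = span ((\<lambda>x. x) ` B)"
    using linear_independent_extend_subspace[OF B(1), of "\<lambda>x. x"] by blast
  have "span B \<subseteq> range f"
    using B(2) Suc.prems(1) by (intro span_minimal linear_subspace_image subspace_UNIV)
  then have spanB: "span B = range f" using B(3) by blast
  have id: "P x = x" if "x \<in> range f" for x
    using that linear_eq_on_span[OF P(1) linear_id, of B x] P(2) spanB by simp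
  have rP: "P x \<in> range f" for x
    using P(3) spanB by auto
  have lin: "linear (\<lambda>x. f (P x))"
    using linear_compose[OF P(1) Suc.prems(1)] by (simp add: o_def)
  have pow: "((\<lambda>x. f (P x)) ^^ n) x = (f ^^ n) x" if "x \<in> range f" for n x
    using that by (induction n arbitrary: x) (simp_all add: funpow_swap1 id del: funpow.simps(2) add: funpow_Suc_right)
  have "((\<lambda>x. f (P x)) ^^ Suc k) x = 0" for x
  proof -
    have "((\<lambda>x. f (P x)) ^^ Suc k) x = (f ^^ Suc k) (P x)"
      by (simp add: funpow_Suc_right pow del: funpow.simps(2))
    also obtain z where "P x = f z" using rP by blast
    then have "(f ^^ Suc k) (P x) = (f ^^ Suc (Suc k)) z"
      by (simp add: funpow_Suc_right del: funpow.simps(2))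
    finally show ?thesis using Suc.prems(2) by metis
  qed
  then have "lin_trace (\<lambda>x. f (P x)) = 0" by (rule Suc.IH[OF lin])
  then show ?case
    using lin_trace_comp_commute[OF Suc.prems(1) P(1)] id by simp
qed

lemma adjoint_wrt:
  fixes g :: "'a::euclidean_space \<Rightarrow> 'a \<Rightarrow> real"
  assumes g: "inner_product g"
  shows inner_product_represent: "linear \<phi> \<Longrightarrow> \<exists>!w. \<forall>x. \<phi> x = g x w"
    and adjoint_wrt_works: "linear f \<Longrightarrow> g (f x) y = g x (adjoint_wrt g f y)"
    and lin_trace_adjoint_wrt: "linear f \<Longrightarrow> lin_trace (adjoint_wrt g f) = lin_trace f"
    and linear_adjoint_wrt: "linear f \<Longrightarrow> linear (adjoint_wrt g f)"
proof -
  have bl: "bilinear g" and sym: "\<And>x y. g x y = g y x" and pos: "\<And>x. g x x = 0 \<Longrightarrow> x = 0"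
    using g by (auto simp: inner_product_def)
  have ll: "linear (\<lambda>x. g x y)" and lr: "linear (g y)" for y
    using bl by (auto simp: bilinear_def)
  define T where "T y = (\<Sum>b\<in>Basis. g b y *\<^sub>R b)" for y
  have T: "g x y = x \<bullet> T y" for x y
  proof -
    have "g x y = g (\<Sum>b\<in>Basis. (x \<bullet> b) *\<^sub>R b) y"
      by (simp add: euclidean_representation)
    also have "\<dots> = x \<bullet> T y"
      by (simp add: linear_sum[OF ll] linear_cmul[OF ll] T_def inner_sum_right mult.commute)
    finally show ?thesis .
  qed
  have linT: "linear T"
    unfolding T_def by (rule linearI) (simp_all add: linear_add[OF lr] linear_cmul[OF lr]
        scaleR_add_left sum.distrib scaleR_sum_right)
  have injT: "inj T"
    unfolding linear_injective_0[OF linT] using T pos by (metis inner_zero_right)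
  have surjT: "surj T"
    using linT injT by (simp add: linear_injective_imp_surjective)
  have ex: "\<exists>!w. \<forall>x. \<phi> x = g x w" if phi: "linear \<phi>" for \<phi> :: "'a \<Rightarrow> real"
  proof -
    have phi': "\<phi> x = x \<bullet> adjoint \<phi> 1" for x
      using adjoint_works[OF phi, of x 1] by simp
    obtain w where w: "T w = adjoint \<phi> 1" using surjT by (metis surj_def)
    show ?thesis
    proof (rule ex1I[of _ w])
      show "\<forall>x. \<phi> x = g x w" by (simp add: T w phi')
    next
      fix w' assume "\<forall>x. \<phi> x = g x w'"
      then have "T w' = T w" by (intro vector_eq_ldot[THEN iffD1]) (simp add: T w phi')
      then show "w' = w" using injT by (simp add: inj_eq)
    qed
  qed
  show "linear \<phi> \<Longrightarrow> \<exists>!w. \<forall>x. \<phi> x = g x w" by (rule ex)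
  have adj: "g (f x) y = g x (adjoint_wrt g f y)" if f: "linear f" for f x y
  proof -
    have "\<exists>!w. \<forall>x. g (f x) y = g x w" for y
      using ex[of "\<lambda>x. g (f x) y"] linear_compose[OF f ll[of y]] by (simp add: o_def)
    then have "\<exists>f'. \<forall>x y. g (f x) y = g x (f' y)" by metis
    then show ?thesis unfolding adjoint_wrt_def by (rule someI2_ex) blast
  qed
  show "linear f \<Longrightarrow> g (f x) y = g x (adjoint_wrt g f y)" by (rule adj)
  have eqI: "w = w'" if "\<And>x. g x w = g x w'" for w w'
    using ex[OF ll[of w]] that sym by metis
  have lin: "linear (adjoint_wrt g f)" if f: "linear f" for f
    by (rule linearI; rule eqI)
      (simp_all add: adj[OF f, symmetric] linear_add[OF lr] linear_cmul[OF lr])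
  show "linear f \<Longrightarrow> linear (adjoint_wrt g f)" by (rule lin)
  show "lin_trace (adjoint_wrt g f) = lin_trace f" if f: "linear f"
  proof -
    have TA: "T (adjoint_wrt g f y) = adjoint f (T y)" for y
    proof -
      have "x \<bullet> T (adjoint_wrt g f y) = x \<bullet> adjoint f (T y)" for x
        unfolding adjoint_works[OF f] T[symmetric] by (rule adj[OF f, symmetric])
      then show ?thesis using vector_eq_ldot by blast
    qed
    obtain S where S: "linear S" "\<And>x. S (T x) = x" "\<And>x. T (S x) = x"
      using linear_injective_isomorphism[OF linT injT] by blast
    have "lin_trace (adjoint_wrt g f) = lin_trace (\<lambda>y. S (adjoint f (T y)))"
      by (simp add: TA[symmetric] S)
    also have "\<dots> = lin_trace (\<lambda>y. adjoint f (T (S y)))"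
      using lin_trace_comp_commute[OF S(1) linear_compose[OF linT adjoint_linear[OF f]]]
      by (simp add: o_def)
    also have "\<dots> = lin_trace f"
      by (simp add: S lin_trace_def adjoint_clauses[OF f] inner_commute)
    finally show ?thesis .
  qed
qed

lemma foldr_alternate:
  "((\<lambda>x. br u (br v x)) ^^ k) x = foldr br (concat (replicate k [u, v])) x"
  by (induction k) simp_all

theorem ricci_nilpotent:
  fixes br :: "'a::euclidean_space \<Rightarrow> 'a \<Rightarrow> 'a"
  assumes lie: "real_lie_algebra br" and nil: "nilpotent_lie br" and g: "inner_product g"
  shows "ricci br g u v = - 1/2 * lin_trace (\<lambda>x. br u (adjoint_wrt g (br v) x))
                          - 1/4 * lin_trace (\<lambda>x. J_map br g u (J_map br g v x))"
proof -
  have gsym: "g x y = g y x" for x y using g by (simp add: inner_product_def)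
  have lr: "linear (g y)" and ll: "linear (\<lambda>x. g x y)" for y
    using g by (auto simp: inner_product_def bilinear_def)
  have br_r: "linear (br x)" and br_l: "linear (\<lambda>y. br y x)" and alt: "br x x = 0" for x
    using lie by (auto simp: real_lie_algebra_def bilinear_def)
  have skew: "br x y = - br y x" for x y
  proof -
    have "br x y + br y x = 0"
      using alt[of "x + y"] alt[of x] alt[of y] 
      by (simp add: linear_add[OF br_r] linear_add[OF br_l] add.commute)
    then show ?thesis by (simp add: eq_neg_iff_add_eq_0)
  qed
  have eqI: "w = w'" if "\<And>x. g x w = g x w'" for w w'
    using inner_product_represent[OF g ll[of w]] that gsym by metis
  define A where "A x = adjoint_wrt g (br x)" for x
  define J where "J = J_map br g"
  have J: "J x y = A y x" for x y by (simp add: J_def J_map_def A_def)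
  have A: "g (br x y) z = g y (A x z)" for x y z
    unfolding A_def by (rule adjoint_wrt_works[OF g br_r])
  have A': "g z (br x y) = g (A x z) y" for x y z using A gsym by metis
  have linA: "linear (A x)" for x
    unfolding A_def by (rule linear_adjoint_wrt[OF g br_r])
  have linJ: "linear (J x)" for x
    unfolding J
    by (rule linearI; rule eqI)
      (simp_all add: A[symmetric] linear_add[OF br_l] linear_cmul[OF br_l] linear_add[OF lr] linear_cmul[OF lr]
        linear_add[OF ll] linear_cmul[OF ll])
  have Jskew: "g (J x y) z = - g y (J x z)" for x y z
  proof -
    have "g (J x y) z = g x (br y z)" by (simp add: J A')
    also have "\<dots> = - g x (br z y)" by (simp add: skew[of y z] linear_neg[OF lr])
    also have "g x (br z y) = g y (J x z)" by (simp add: J A' gsym[of y])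
    finally show ?thesis .
  qed
  define P where "P x y = - (1/2) *\<^sub>R (br x y + A x y + J x y)" for x y
  have LC: "levi_civita br g x y = br x y + P x y" for x y
  proof -
    have K: "2 * g (br x y + P x y) w = g (br x y) w - g (br y w) x + g (br w x) y" for w
    proof -
      have "g (br y w) x = g (J x y) w" using A gsym J by metis
      moreover have "g (br w x) y = - g (A x y) w"
        using skew[of w x] A[of x w y] gsym linear_neg[OF ll] by metis
      ultimately show ?thesis
        by (simp add: P_def linear_add[OF ll] linear_cmul[OF ll] linear_neg[OF ll] linear_diff[OF ll] algebra_simps)
    qed
    show ?thesis unfolding levi_civita_def
    proof (rule the_equality)
      fix z assume z: "\<forall>w. 2 * g z w = g (br x y) w - g (br y w) x + g (br w x) y"
      show "z = br x y + P x y"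
        by (rule eqI) (use z K gsym in \<open>smt (verit)\<close>)
    qed (use K in blast)
  qed
  have linP: "linear (P x)" for x
    unfolding P_def using br_r linA linJ
    by (intro linear_compose_scale_right linear_compose_add)
  have tors: "levi_civita br g x y = P y x" for x y
  proof -
    have half: "b - (1/2) *\<^sub>R (b + c) = - (1/2) *\<^sub>R (- b + c)" for b c :: 'a
      by (simp add: algebra_simps flip: scaleR_add_left)
    have "P y x = - (1/2) *\<^sub>R (- br x y + (A x y + J x y))"
      unfolding P_def using skew[of y x] by (simp add: J add.commute add.left_commute)
    moreover have "levi_civita br g x y = br x y - (1/2) *\<^sub>R (br x y + (A x y + J x y))"
      unfolding LC P_def by (simp add: add.assoc)
    ultimately show ?thesis by (simp only: half)
  qed
  obtain k where k: "\<And>xs y. length xs = k \<Longrightarrow> foldr br xs y = 0"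
    using nil by (auto simp: nilpotent_lie_def)
  have k_ge: "foldr br xs y = 0" if "length xs \<ge> k" for xs y
  proof -
    have "foldr br xs y = foldr br (take k xs) (foldr br (drop k xs) y)"
      by (metis append_take_drop_id foldr_append comp_apply)
    then show ?thesis using k[of "take k xs"] that by simp
  qed
  have tr_ad: "lin_trace (br x) = 0" for x
  proof (rule lin_trace_nilpotent[OF br_r, where k = k])
    fix y have pow: "(br x ^^ m) y = foldr br (replicate m x) y" for m
      by (induction m) simp_all
    show "(br x ^^ Suc k) y = 0" unfolding pow by (rule k_ge) simp
  qed
  have lin2: "linear (\<lambda>z. p (q z))" if "linear p" "linear q" for p q :: "'a \<Rightarrow> 'a"
    using linear_compose[OF that(2,1)] by (simp add: o_def)
  have killing: "lin_trace (\<lambda>z. br x (br y z)) = 0" for x y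
  proof (rule lin_trace_nilpotent[OF lin2[OF br_r br_r], where k = k])
    fix z show "((\<lambda>z. br x (br y z)) ^^ Suc k) z = 0"
      unfolding foldr_alternate by (rule k_ge) (simp add: length_concat sum_list_replicate)
  qed
  have adj: "lin_trace p = lin_trace q"
    if "linear p" "\<And>x y. g (p x) y = g x (q y)" for p q
  proof -
    have "adjoint_wrt g p = q"
      using that(2) adjoint_wrt_works[OF g that(1)] by (auto simp: fun_eq_iff intro!: eqI)
    then show ?thesis using lin_trace_adjoint_wrt[OF g that(1)] by simp
  qed
  have trJ: "lin_trace (J x) = 0" for x
    using adj[of "J x" "\<lambda>y. - J x y"] linJ Jskew by (simp add: lin_trace_simps linear_neg[OF lr])
  have trA: "lin_trace (A x) = 0" for x
    using adj[OF br_r A] tr_ad by simp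
  have trP: "lin_trace (P x) = 0" for x
    unfolding P_def by (simp add: lin_trace_simps tr_ad trA trJ)
  have AA: "lin_trace (\<lambda>z. A x (A y z)) = 0" for x y
    using adj[of "\<lambda>z. br y (br x z)" "\<lambda>z. A x (A y z)"] killing
    by (simp add: lin2[OF br_r br_r] A)
  have Abr: "lin_trace (\<lambda>z. A x (br y z)) = lin_trace (\<lambda>z. br x (A y z))" for x y
  proof -
    have "lin_trace (\<lambda>z. A x (br y z)) = lin_trace (\<lambda>z. A y (br x z))"
      by (rule adj) (simp_all add: lin2[OF linA br_r] A'[symmetric] A gsym[of "A _ _"])
    then show ?thesis
      using lin_trace_comp_commute[OF linA br_r] by simp
  qed
  have SJ: "lin_trace (\<lambda>z. br x (J y z)) + lin_trace (\<lambda>z. A x (J y z)) = 0" for x y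
  proof -
    have "lin_trace (\<lambda>z. br x (J y z)) = lin_trace (\<lambda>z. - J y (A x z))"
      by (rule adj) (simp_all add: lin2[OF br_r linJ] A Jskew linear_neg[OF lr])
    then show ?thesis
      using lin_trace_comp_commute[OF linA linJ] by (simp add: lin_trace_simps)
  qed
  have JS: "lin_trace (\<lambda>z. J y (br x z)) + lin_trace (\<lambda>z. J y (A x z)) = 0" for x y
    using SJ[of x y] lin_trace_comp_commute[OF linA linJ] lin_trace_comp_commute[OF br_r linJ] by simp
  have "ricci br g u v = lin_trace (\<lambda>w. P (levi_civita br g u v) w - br u (P v w) - P u (P v w)
      + P v (br u w))"
    unfolding ricci_def curvature_def
  proof (intro arg_cong[of _ _ lin_trace] ext)
    fix w
    show "levi_civita br g w (levi_civita br g u v) - levi_civita br g u (levi_civita br g w v)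
        - levi_civita br g (br w u) v
      = P (levi_civita br g u v) w - br u (P v w) - P u (P v w) + P v (br u w)"
      unfolding tors[of w] tors[of "br w u"] LC[of u "P v w"]
      using skew[of w u] by (simp add: linear_neg[OF linP])
  qed
  also have "\<dots> = - lin_trace (\<lambda>w. P u (P v w))"
    using lin_trace_comp_commute[OF br_r linP] by (simp add: lin_trace_simps trP)
  also have "(\<lambda>w. P u (P v w)) = (\<lambda>w. (1/4) *\<^sub>R
      (br u (br v w) + br u (A v w) + br u (J v w) + A u (br v w) + A u (A v w) + A u (J v w)
        + (J u (br v w) + J u (A v w)) + J u (J v w)))"
  proof
    fix w
    have "P u (P v w) = P u (- (1/2) *\<^sub>R (br v w + A v w + J v w))"
      by (simp only: P_def[of v w])
    also have "\<dots> = - (1/2) *\<^sub>R P u (br v w + A v w + J v w)"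
      by (rule linear_cmul[OF linP])
    finally show "P u (P v w) = (1/4) *\<^sub>R
      (br u (br v w) + br u (A v w) + br u (J v w) + A u (br v w) + A u (A v w) + A u (J v w)
        + (J u (br v w) + J u (A v w)) + J u (J v w))"
      by (simp add: P_def linear_add[OF br_r] linear_add[OF linA] linear_add[OF linJ] add_ac)
  qed
  also have "- lin_trace \<dots> = - 1/2 * lin_trace (\<lambda>x. br u (A v x)) - 1/4 * lin_trace (\<lambda>x. J u (J v x))"
    using SJ[of u v] JS[of u v] by (simp add: lin_trace_simps killing AA Abr field_simps)
  finally show ?thesis by (simp add: A_def J_def)
qed

end

theory Submission
  imports Defs
begin

(* By Koszul's formula the Ricci tensor does not change when the metric is rescaled, so the given basis
   may be taken orthonormal.  There ric(x,y) = -1/2 sum_i <[x,v_i],[y,v_i]>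
   + 1/4 sum_{i,j} <[v_i,v_j],x> <[v_i,v_j],y>, and the metric is Schouten like iff Ric - c Id is a
   derivation for some real c.  Both cases are treated at once by [v_1,v_2] = a v_3 + p v_4 + q v_5,
   [v_1,v_3] = b v_5.  Applying the derivation D = Ric - c Id to [v_1,v_4] = 0 gives p = 0, the
   v_3-component of D [v_1,v_3] gives q = 0, and the remaining conditions are c = -3/2 a^2 and
   c = -3/2 b^2. *)

section \<open>Coordinates and traces in an orthonormal basis\<close>

lemma inner_product_bilinear:
  assumes "inner_product h"
  shows inner_product_commute: "h x y = h y x"
    and inner_product_linear_left: "linear (\<lambda>x. h x y)"
    and inner_product_linear_right: "linear (h x)"
  using assms by (auto simp: inner_product_def bilinear_def)

text \<open>Both sides are linear in \<open>x\<close> and agree on the vectors \<open>v i\<close>,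
  which span the space.\<close>

lemma orthonormal_basis_expansion:
  assumes h: "inner_product h" and v: "orthonormal_basis h n v"
  shows "x = (\<Sum>i\<in>{1..n}. h x (v i) *\<^sub>R v i)"
proof -
  note lin = inner_product_linear_left[OF h]
  have on: "h (v i) (v j) = (if i = j then 1 else 0)" if "i \<in> {1..n}" "j \<in> {1..n}" for i j
    using v that by (auto simp: orthonormal_basis_def)
  have "linear (\<lambda>x. \<Sum>i\<in>{1..n}. h x (v i) *\<^sub>R v i)" (is "linear ?P")
    by (rule linearI) (simp_all add: linear_add[OF lin] linear_cmul[OF lin] scaleR_add_left
        sum.distrib scaleR_sum_right)
  moreover have "?P y = y" if "y \<in> v ` {1..n}" for y
  proof -
    obtain k where k: "k \<in> {1..n}" "y = v k" using \<open>y \<in> v ` {1..n}\<close> by blast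
    have "(\<Sum>i\<in>{1..n}. h y (v i) *\<^sub>R v i) = (\<Sum>i\<in>{1..n}. if i = k then v i else 0)"
      by (rule sum.cong) (use k on in auto)
    then show ?thesis using k by simp
  qed
  moreover have "x \<in> span (v ` {1..n})" using v by (simp add: orthonormal_basis_def)
  ultimately have "?P x = x"
    using linear_eq_on_span[of ?P "\<lambda>x. x" "v ` {1..n}" x] linear_ident by blast
  then show ?thesis by simp
qed

lemma orthonormal_basis_eqI:
  assumes "inner_product h" "orthonormal_basis h n v"
    and "\<And>i. i \<in> {1..n} \<Longrightarrow> h x (v i) = h y (v i)"
  shows "x = y"
proof -
  have "(\<Sum>i\<in>{1..n}. h x (v i) *\<^sub>R v i) = (\<Sum>i\<in>{1..n}. h y (v i) *\<^sub>R v i)"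
    using assms(3) by simp
  then show ?thesis
    using orthonormal_basis_expansion[OF assms(1,2), of x]
      orthonormal_basis_expansion[OF assms(1,2), of y] by simp
qed

lemma orthonormal_basis_parseval:
  assumes h: "inner_product h" and v: "orthonormal_basis h n v"
  shows "h x y = (\<Sum>i\<in>{1..n}. h x (v i) * h y (v i))"
proof -
  note lin = inner_product_linear_right[OF h]
  have "h x y = h x (\<Sum>i\<in>{1..n}. h y (v i) *\<^sub>R v i)"
    using orthonormal_basis_expansion[OF h v, of y] by simp
  also have "\<dots> = (\<Sum>i\<in>{1..n}. h x (v i) * h y (v i))"
    by (simp add: linear_sum[OF lin] linear_cmul[OF lin] mult.commute)
  finally show ?thesis .
qed

text \<open>\<open>lin_trace\<close> is written in the canonical basis, which bears no relation to
  \<open>h\<close>. Expanding each canonical vector along \<open>v\<close> and swapping the two sums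
  reassembles \<open>f (v i)\<close> from its canonical coordinates inside \<open>h\<close>.\<close>

lemma lin_trace_orthonormal_basis:
  fixes f :: "'a::euclidean_space \<Rightarrow> 'a"
  assumes h: "inner_product h" and v: "orthonormal_basis h n v" and f: "linear f"
  shows "lin_trace f = (\<Sum>i\<in>{1..n}. h (f (v i)) (v i))"
proof -
  note lin = inner_product_linear_left[OF h]
  have "f b \<bullet> b = (\<Sum>i\<in>{1..n}. h b (v i) * (f (v i) \<bullet> b))" for b
  proof -
    have "f b = f (\<Sum>i\<in>{1..n}. h b (v i) *\<^sub>R v i)"
      using orthonormal_basis_expansion[OF h v, of b] by simp
    then show ?thesis
      by (simp add: linear_sum[OF f] linear_cmul[OF f] inner_sum_left)
  qed
  then have "lin_trace f = (\<Sum>i\<in>{1..n}. \<Sum>b\<in>Basis. h b (v i) * (f (v i) \<bullet> b))"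
    unfolding lin_trace_def by (simp add: sum.swap[of _ _ Basis])
  also have "\<dots> = (\<Sum>i\<in>{1..n}. h (\<Sum>b\<in>Basis. (f (v i) \<bullet> b) *\<^sub>R b) (v i))"
    by (simp add: linear_sum[OF lin] linear_cmul[OF lin] mult.commute)
  finally show ?thesis by (simp add: euclidean_representation)
qed

section \<open>The Ricci tensor of a nilpotent Lie algebra in an orthonormal basis\<close>

lemma real_lie_algebra_skew:
  assumes "real_lie_algebra br"
  shows "br x y = - br y x"
proof -
  have l: "linear (br z)" "linear (\<lambda>y. br y z)" "br z z = 0" for z
    using assms by (auto simp: real_lie_algebra_def bilinear_def)
  have "br x y + br y x = 0"
    using l(3)[of "x + y"] l(3)[of x] l(3)[of y]
    by (simp add: linear_add[OF l(1)] linear_add[OF l(2)] add.commute)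
  then show ?thesis by (simp add: eq_neg_iff_add_eq_0)
qed

text \<open>The two traces in \<open>ricci_nilpotent\<close> are evaluated on \<open>v\<close>. The
  transpose of ad_y moves across \<open>h\<close> in the first one; skewness of J_x produces the
  sign change in the second one.\<close>

lemma ricci_orthonormal_basis:
  fixes br :: "'a::euclidean_space \<Rightarrow> 'a \<Rightarrow> 'a"
  assumes lie: "real_lie_algebra br" and nil: "nilpotent_lie br"
    and h: "inner_product h" and v: "orthonormal_basis h n v"
  shows "ricci br h x y = - 1/2 * (\<Sum>i\<in>{1..n}. h (br x (v i)) (br y (v i)))
    + 1/4 * (\<Sum>i\<in>{1..n}. \<Sum>j\<in>{1..n}. h (br (v i) (v j)) x * h (br (v i) (v j)) y)"
proof -
  note sym = inner_product_commute[OF h]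
  note ll = inner_product_linear_left[OF h]
  note lr = inner_product_linear_right[OF h]
  have br_r: "linear (br z)" and br_l: "linear (\<lambda>y. br y z)" for z
    using lie by (auto simp: real_lie_algebra_def bilinear_def)
  define A where "A z = adjoint_wrt h (br z)" for z
  have A: "h (br z u) w = h u (A z w)" for z u w
    unfolding A_def by (rule adjoint_wrt_works[OF h br_r])
  have linA: "linear (A z)" for z
    unfolding A_def by (rule linear_adjoint_wrt[OF h br_r])
  have lin2: "linear (\<lambda>z. p (q z))" if "linear p" "linear q" for p q :: "'a \<Rightarrow> 'a"
    using linear_compose[OF that(2,1)] by (simp add: o_def)
  have linJ: "linear (\<lambda>z. A z u)" for u
    by (rule linearI; rule orthonormal_basis_eqI[OF h v])
      (simp_all add: sym[of "A _ _"] A[symmetric] linear_add[OF br_l] linear_cmul[OF br_l]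
        linear_add[OF lr] linear_cmul[OF lr] linear_add[OF ll] linear_cmul[OF ll])
  \<comment> \<open>Cyclicity puts the transpose outermost, where it can be moved to the other
    argument of \<open>h\<close>.\<close>
  have "lin_trace (\<lambda>z. br x (A y z)) = lin_trace (\<lambda>z. A y (br x z))"
    by (rule lin_trace_comp_commute[OF br_r linA])
  also have "\<dots> = (\<Sum>i\<in>{1..n}. h (br x (v i)) (br y (v i)))"
    by (subst lin_trace_orthonormal_basis[OF h v lin2[OF linA br_r]])
      (simp add: sym[of "A _ _"] A[symmetric] sym[of "br y _"])
  finally have 1: "lin_trace (\<lambda>z. br x (A y z)) = \<dots>" .
  \<comment> \<open>As J_u z is \<open>A z u\<close>, this says that J_u is skew with respect to
    \<open>h\<close>.\<close>
  have Jskew: "h (A z u) w = - h (A w u) z" for z u w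
  proof -
    have "h (A z u) w = h (br z w) u" using A sym by metis
    also have "\<dots> = - h (br w z) u"
      using real_lie_algebra_skew[OF lie, of z w] by (simp add: linear_neg[OF ll])
    also have "h (br w z) u = h (A w u) z" using A sym by metis
    finally show ?thesis .
  qed
  \<comment> \<open>The map under the trace is J_x composed with J_y.\<close>
  have "lin_trace (\<lambda>z. A (A z y) x) = (\<Sum>i\<in>{1..n}. h (A (A (v i) y) x) (v i))"
    by (rule lin_trace_orthonormal_basis[OF h v lin2[OF linJ linJ]])
  also have "\<dots> = - (\<Sum>i\<in>{1..n}. h (A (v i) x) (A (v i) y))"
    by (simp add: Jskew[of "A _ y"] sum_negf)
  \<comment> \<open>Parseval brings in the second index: the coefficient of \<open>A (v i) x\<close>
    along \<open>v j\<close> is \<open>h (br (v i) (v j)) x\<close>.\<close>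
  also have "\<dots> = - (\<Sum>i\<in>{1..n}. \<Sum>j\<in>{1..n}. h (br (v i) (v j)) x * h (br (v i) (v j)) y)"
    by (subst orthonormal_basis_parseval[OF h v]) (simp add: A sym[of "v _"])
  finally show ?thesis
    unfolding ricci_nilpotent[OF lie nil h] J_map_def using 1 by (simp add: A_def)
qed

section \<open>Rescaling the metric\<close>

text \<open>Every term of Koszul's formula is homogeneous of degree one in the metric, so the factor
  cancels.\<close>

lemma levi_civita_scale:
  assumes "\<eta> \<noteq> 0"
  shows "levi_civita br (\<lambda>x y. \<eta> * g x y) = levi_civita br g"
proof -
  have "2 * (\<eta> * g x w) = \<eta> * p - \<eta> * q + \<eta> * r \<longleftrightarrow> 2 * g x w = p - q + r" for x w p q r
  proof -
    have "2 * (\<eta> * g x w) = \<eta> * p - \<eta> * q + \<eta> * r \<longleftrightarrow> \<eta> * (2 * g x w) = \<eta> * (p - q + r)"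
      by (simp add: algebra_simps)
    then show ?thesis using assms by simp
  qed
  then show ?thesis by (simp add: levi_civita_def fun_eq_iff)
qed

lemma ricci_scale: "\<eta> \<noteq> 0 \<Longrightarrow> ricci br (\<lambda>x y. \<eta> * g x y) = ricci br g"
  by (simp add: ricci_def curvature_def levi_civita_scale fun_eq_iff)

text \<open>The constant \<open>c\<close> in the definition is free, so every real factor is already
  reached with \<open>l0 = 0\<close>.\<close>

lemma schouten_like_iff:
  "schouten_like br g \<longleftrightarrow>
     (\<exists>c D. derivation br D \<and> symmetric_wrt g D \<and> (\<forall>x y. ricci br g x y = c * g x y + g (D x) y))"
proof
  assume "\<exists>c D. derivation br D \<and> symmetric_wrt g D \<and>
    (\<forall>x y. ricci br g x y = c * g x y + g (D x) y)"
  then obtain c D where "derivation br D" "symmetric_wrt g D"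
    "\<forall>x y. ricci br g x y = (scalar_curvature br g * 0 + c) * g x y + g (D x) y" by auto
  then show "schouten_like br g" unfolding schouten_like_def by blast
qed (unfold schouten_like_def, blast)

lemma inner_product_scale:
  assumes "inner_product g" "\<eta> > 0"
  shows "inner_product (\<lambda>x y. \<eta> * g x y)"
  using assms
  by (auto simp: inner_product_def bilinear_def linear_iff algebra_simps)

text \<open>The Ricci tensor stays fixed while the metric gains a factor \<eta>, so both
  \<open>c\<close> and \<open>D\<close> are divided by \<eta>.\<close>

lemma schouten_like_scaleD:
  assumes br: "bilinear br" and g: "inner_product g" and eta: "\<eta> > 0"
    and s: "schouten_like br g"
  shows "schouten_like br (\<lambda>x y. \<eta> * g x y)"
proof -
  obtain c D where D: "derivation br D" "symmetric_wrt g D"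
    and ric: "\<And>x y. ricci br g x y = c * g x y + g (D x) y"
    using s unfolding schouten_like_iff by blast
  note ll = inner_product_linear_left[OF g]
  note lr = inner_product_linear_right[OF g]
  have b: "linear (br x)" "linear (\<lambda>x. br x y)" for x y
    using br by (auto simp: bilinear_def)
  have "derivation br (\<lambda>x. (1/\<eta>) *\<^sub>R D x)"
    using D(1) by (auto simp: derivation_def linear_cmul[OF b(1)] linear_cmul[OF b(2)]
        scaleR_add_right intro: linear_compose_scale_right)
  moreover have "symmetric_wrt (\<lambda>x y. \<eta> * g x y) (\<lambda>x. (1/\<eta>) *\<^sub>R D x)"
    using D(2) by (simp add: symmetric_wrt_def linear_cmul[OF ll] linear_cmul[OF lr])
  moreover have "ricci br (\<lambda>x y. \<eta> * g x y) x y
      = (c/\<eta>) * (\<eta> * g x y) + \<eta> * g ((1/\<eta>) *\<^sub>R D x) y" for x y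
    using eta by (simp add: ricci_scale ric linear_cmul[OF ll])
  ultimately show ?thesis unfolding schouten_like_iff by blast
qed

lemma schouten_like_scale:
  assumes "bilinear br" "inner_product g" "\<eta> > 0"
  shows "schouten_like br (\<lambda>x y. \<eta> * g x y) \<longleftrightarrow> schouten_like br g"
proof
  assume "schouten_like br (\<lambda>x y. \<eta> * g x y)"
  \<comment> \<open>Rescaling the already scaled metric by the inverse factor gives \<open>g\<close>
    back.\<close>
  from schouten_like_scaleD[OF assms(1) inner_product_scale[OF assms(2,3)] _ this, of "1/\<eta>"]
  show "schouten_like br g" using assms(3) by simp
qed (use schouten_like_scaleD[OF assms] in blast)

section \<open>The two families of brackets in an orthonormal basis\<close>

lemma schouten_like_orthonormal_basis_iff:
  fixes br :: "'a::euclidean_space \<Rightarrow> 'a \<Rightarrow> 'a" and v :: "nat \<Rightarrow> 'a"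
  assumes lie: "real_lie_algebra br" and h: "inner_product h" and v: "orthonormal_basis h 5 v"
    and nz: "only_nonzero_brackets br 5 v {(1, 2), (1, 3)}"
    and b12: "br (v 1) (v 2) = a *\<^sub>R v 3 + p *\<^sub>R v 4 + q *\<^sub>R v 5"
    and b13: "br (v 1) (v 3) = b *\<^sub>R v 5"
    and a: "a > 0" and b: "b > 0"
  shows "schouten_like br h \<longleftrightarrow> p = 0 \<and> q = 0 \<and> a = b"
proof -
  note ll = inner_product_linear_left[OF h]
  note lr = inner_product_linear_right[OF h]
  note sym = inner_product_commute[OF h]
  have br_r: "linear (br z)" and br_l: "linear (\<lambda>y. br y z)" and alt: "br z z = 0" for z
    using lie by (auto simp: real_lie_algebra_def bilinear_def)
  note skew = real_lie_algebra_skew[OF lie]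
  have I: "{1..5::nat} = {1,2,3,4,5}" by auto
  have nz0: "br (v i) (v j) = 0"
    if "i \<in> {1..5}" "j \<in> {1..5}" "i < j" "(i, j) \<notin> {(1, 2), (1, 3)}" for i j
    using nz that unfolding only_nonzero_brackets_def by blast
  have z: "br (v 1) (v 4) = 0" "br (v 1) (v 5) = 0" "br (v 2) (v 3) = 0" "br (v 2) (v 4) = 0"
    "br (v 2) (v 5) = 0" "br (v 3) (v 4) = 0" "br (v 3) (v 5) = 0" "br (v 4) (v 5) = 0"
    by (rule nz0; simp)+
  have z': "br (v 2) (v 1) = - br (v 1) (v 2)" "br (v 3) (v 1) = - br (v 1) (v 3)"
    "br (v 4) (v 1) = 0" "br (v 5) (v 1) = 0" "br (v 3) (v 2) = 0" "br (v 4) (v 2) = 0"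
    "br (v 5) (v 2) = 0" "br (v 4) (v 3) = 0" "br (v 5) (v 3) = 0" "br (v 5) (v 4) = 0"
    using z skew[of "v 2" "v 1"] skew[of "v 3" "v 1"] skew[of "v 4" "v 1"]
      skew[of "v 5" "v 1"] skew[of "v 3" "v 2"] skew[of "v 4" "v 2"] skew[of "v 5" "v 2"]
      skew[of "v 4" "v 3"] skew[of "v 5" "v 3"] skew[of "v 5" "v 4"] by simp_all
  have on: "h (v i) (v j) = (if i = j then 1 else 0)" if "i \<in> {1..5}" "j \<in> {1..5}" for i j
    using v that by (auto simp: orthonormal_basis_def)
  note hsimps = linear_add[OF ll] linear_cmul[OF ll] linear_neg[OF ll] linear_0[OF ll]
    linear_add[OF lr] linear_cmul[OF lr] linear_neg[OF lr] linear_0[OF lr]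
  have exp: "x = h x (v 1) *\<^sub>R v 1 + h x (v 2) *\<^sub>R v 2 + h x (v 3) *\<^sub>R v 3 + h x (v 4) *\<^sub>R v 4
      + h x (v 5) *\<^sub>R v 5" for x
    using orthonormal_basis_expansion[OF h v, of x] unfolding I
    by (simp add: add.assoc del: One_nat_def)
  have parseval: "h x y = h x (v 1) * h y (v 1) + h x (v 2) * h y (v 2) + h x (v 3) * h y (v 3)
      + h x (v 4) * h y (v 4) + h x (v 5) * h y (v 5)" for x y
    using orthonormal_basis_parseval[OF h v, of x y] unfolding I
    by (simp add: add.assoc del: One_nat_def)
  \<comment> \<open>\<open>k\<close> and \<open>l\<close> are the 2x2 minors of the coordinates of
    \<open>x\<close> and \<open>y\<close> that multiply [v_1,v_2] and [v_1,v_3] in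
    \<open>br x y\<close>.\<close>
  define k where "k x y = h x (v 1) * h y (v 2) - h x (v 2) * h y (v 1)" for x y
  define l where "l x y = h x (v 1) * h y (v 3) - h x (v 3) * h y (v 1)" for x y
  have br: "br x y = k x y *\<^sub>R (a *\<^sub>R v 3 + p *\<^sub>R v 4 + q *\<^sub>R v 5) + (l x y * b) *\<^sub>R v 5" for x y
    by (subst exp[of x], subst exp[of y])
      (simp add: linear_add[OF br_r] linear_add[OF br_l] linear_cmul[OF br_r] linear_cmul[OF br_l]
        z z' b12 b13 alt k_def l_def algebra_simps del: One_nat_def)
  have coord: "h (br x y) (v 1) = 0" "h (br x y) (v 2) = 0" "h (br x y) (v 3) = k x y * a"
    "h (br x y) (v 4) = k x y * p" "h (br x y) (v 5) = k x y * q + l x y * b" for x y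
    unfolding br by (simp_all add: hsimps on del: One_nat_def)
  have nil: "nilpotent_lie br"
  proof -
    \<comment> \<open>A bracket lies in the span of v_3, v_4, v_5. Bracketing once more leaves only
      multiples of v_5, which is central.\<close>
    have "br x (br y (br s t)) = 0" for x y s t
    proof (subst br)
      show "k x (br y (br s t)) *\<^sub>R (a *\<^sub>R v 3 + p *\<^sub>R v 4 + q *\<^sub>R v 5)
          + (l x (br y (br s t)) * b) *\<^sub>R v 5 = 0"
        unfolding k_def[of x] l_def[of x] coord unfolding k_def[of y] coord by simp
    qed
    then show ?thesis unfolding nilpotent_lie_def
      by (intro exI[of _ 3]) (auto simp: numeral_eq_Suc length_Suc_conv)
  qed
  \<comment> \<open>The factor 1/4 becomes 1/2 because each nonzero bracket occurs for both orders
    of its indices.\<close>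
  have ric: "ricci br h x y = - 1/2 * (\<Sum>i\<in>{1..5}. h (br x (v i)) (br y (v i)))
     + 1/2 * (h (br (v 1) (v 2)) x * h (br (v 1) (v 2)) y + h (br (v 1) (v 3)) x * h (br (v 1) (v 3)) y)"
    for x y
    unfolding ricci_orthonormal_basis[OF lie nil h v] unfolding I
    by (simp add: z z' alt hsimps algebra_simps del: One_nat_def)
  have ric': "ricci br h x y =
      - 1/2 * ((a^2 + p^2 + q^2 + b^2) * h x (v 1) * h y (v 1) + (a^2 + p^2 + q^2) * h x (v 2) * h y (v 2)
        + b^2 * h x (v 3) * h y (v 3) + b * q * (h x (v 2) * h y (v 3) + h x (v 3) * h y (v 2)))
     + 1/2 * ((a * h x (v 3) + p * h x (v 4) + q * h x (v 5)) * (a * h y (v 3) + p * h y (v 4) + q * h y (v 5))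
        + b^2 * h x (v 5) * h y (v 5))"
    for x y
    unfolding ric unfolding I
    by (subst (1 2 3 4 5) parseval)
      (simp add: coord k_def l_def on hsimps sym[of "v _" x] sym[of "v _" y] b12 b13
        power2_eq_square algebra_simps del: One_nat_def)
  show ?thesis
  proof
    assume "schouten_like br h"
    then obtain c D where D: "derivation br D"
      and rD: "\<And>x y. ricci br h x y = c * h x y + h (D x) y"
      unfolding schouten_like_iff by blast
    have linD: "linear D" and der: "D (br x y) = br (D x) y + br x (D y)" for x y
      using D by (auto simp: derivation_def)
    have hD: "h (D x) y = ricci br h x y - c * h x y" for x y using rD[of x y] by simp
    \<comment> \<open>The derivation rule on basis vectors, read off in the coordinate
      \<open>m\<close>.\<close>
    have e: "h (D (br (v i) (v j))) (v m) = h (br (D (v i)) (v j)) (v m) + h (br (v i) (D (v j))) (v m)"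
      for i j m by (simp add: der hsimps)
    note simps = hD ric' coord k_def l_def on b12 b13 z hsimps linear_add[OF linD]
      linear_cmul[OF linD] linear_0[OF linD]
    \<comment> \<open>D v_4 has v_3-component a p / 2, so the v_5-component of [v_1, D v_4] is a b p
      / 2, while every other term vanishes.\<close>
    have "p = 0"
      using e[of 1 4 5] a b by (simp add: simps del: One_nat_def)
    \<comment> \<open>The left side is a b q / 2 and the right side is - a b q / 2, from the entries
      of Ric at (v_5,v_3) and (v_3,v_2).\<close>
    moreover have "q = 0"
      using e[of 1 3 3] a b by (simp add: simps \<open>p = 0\<close> del: One_nat_def)
    \<comment> \<open>Now \<open>D\<close> is diagonal in \<open>v\<close>. With d_i its
      eigenvalues, [v_1,v_2] gives d_3 = d_1 + d_2, and [v_1,v_3] below gives d_5 = d_1 +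
      d_3.\<close>
    moreover have "c = - 3/2 * a^2"
    proof -
      have "a * c = a * (- 3/2 * a^2)"
        using e[of 1 2 3] by (simp add: simps \<open>p = 0\<close> \<open>q = 0\<close> power2_eq_square algebra_simps del: One_nat_def)
      then show ?thesis using a by (subst (asm) mult_left_cancel) auto
    qed
    moreover have "c = - 3/2 * b^2"
    proof -
      have "b * c = b * (- 3/2 * b^2)"
        using e[of 1 3 5] by (simp add: simps \<open>p = 0\<close> \<open>q = 0\<close> power2_eq_square algebra_simps del: One_nat_def)
      then show ?thesis using b by (subst (asm) mult_left_cancel) auto
    qed
    ultimately show "p = 0 \<and> q = 0 \<and> a = b"
      using a b by (simp add: power2_eq_iff)
  next
    assume pq: "p = 0 \<and> q = 0 \<and> a = b"
    \<comment> \<open>This is Ric - c Id with c = - 3/2 a^2, since Ric is diagonal with entries -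
      a^2, - a^2/2, 0, 0, a^2/2. The weights 1, 2, 3, 3, 4 satisfy 1 + 2 = 3 and 1 + 3 = 4, which
      makes it a derivation.\<close>
    define D where "D x = (a^2/2) *\<^sub>R (h x (v 1) *\<^sub>R v 1 + (2 * h x (v 2)) *\<^sub>R v 2
      + (3 * h x (v 3)) *\<^sub>R v 3 + (3 * h x (v 4)) *\<^sub>R v 4 + (4 * h x (v 5)) *\<^sub>R v 5)" for x
    have Dc: "h (D x) (v 1) = a^2/2 * h x (v 1)" "h (D x) (v 2) = a^2 * h x (v 2)"
      "h (D x) (v 3) = 3/2 * a^2 * h x (v 3)" "h (D x) (v 4) = 3/2 * a^2 * h x (v 4)"
      "h (D x) (v 5) = 2 * a^2 * h x (v 5)" for x
      unfolding D_def by (simp_all add: hsimps on del: One_nat_def)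
    have eqI: "x = y" if "h x (v 1) = h y (v 1)" "h x (v 2) = h y (v 2)" "h x (v 3) = h y (v 3)"
      "h x (v 4) = h y (v 4)" "h x (v 5) = h y (v 5)" for x y
      by (rule orthonormal_basis_eqI[OF h v]) (use that in \<open>auto simp: I simp del: One_nat_def\<close>)
    have "linear D"
      by (rule linearI; rule eqI) (simp_all add: Dc hsimps distrib_left del: One_nat_def)
    moreover have "D (br x y) = br (D x) y + br x (D y)" for x y
      by (rule eqI)
        (simp_all add: Dc hsimps coord k_def l_def pq field_simps del: One_nat_def)
    ultimately have "derivation br D" by (simp add: derivation_def)
    moreover have "symmetric_wrt h D"
      unfolding symmetric_wrt_def by (subst (1 2) parseval) (simp add: Dc algebra_simps del: One_nat_def)
    moreover have "ricci br h x y = (- 3/2 * a^2) * h x y + h (D x) y" for x y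
      unfolding ric' parseval[of x y] parseval[of "D x" y]
      by (simp add: Dc pq power2_eq_square field_simps del: One_nat_def)
    ultimately show "schouten_like br h" unfolding schouten_like_iff by blast
  qed
qed

theorem proposition6:
  fixes br :: "'a::euclidean_space \<Rightarrow> 'a \<Rightarrow> 'a"
    and g :: "'a \<Rightarrow> 'a \<Rightarrow> real"
    and v :: "nat \<Rightarrow> 'a"
    and \<eta> \<alpha> \<beta> \<gamma> :: real
  assumes "real_lie_algebra br"
    and "lie_isomorphic br (lie_direct_sum A41 A1)"
    and "inner_product g"
    and "\<eta> > 0"
    and "orthonormal_basis (\<lambda>x y. \<eta> * g x y) 5 v"
    and "\<alpha> > 0" and "\<beta> > 0"
    and "only_nonzero_brackets br 5 v {(1, 2), (1, 3)}"
    and "br (v 1) (v 2) = \<alpha> *\<^sub>R v 3 + \<gamma> *\<^sub>R v 5 \<or>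
         br (v 1) (v 2) = \<alpha> *\<^sub>R v 3 + \<gamma> *\<^sub>R v 4"
    and "br (v 1) (v 3) = \<beta> *\<^sub>R v 5"
  shows "schouten_like br g \<longleftrightarrow> \<gamma> = 0 \<and> \<alpha> = \<beta>"
proof -
  have "bilinear br" using assms(1) by (simp add: real_lie_algebra_def)
  note scale = schouten_like_scale[OF this assms(3,4)]
  \<comment> \<open>The premise on [v_1,v_2] is left open, so that \<open>p\<close> and
    \<open>q\<close> can be chosen separately in each case.\<close>
  note iff = schouten_like_orthonormal_basis_iff[OF assms(1) inner_product_scale[OF assms(3,4)]
      assms(5,8) _ assms(10,6,7), unfolded scale]
  from assms(9) show ?thesis
  proof
    assume "br (v 1) (v 2) = \<alpha> *\<^sub>R v 3 + \<gamma> *\<^sub>R v 5"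
    then show ?thesis using iff[of 0 \<gamma>] by simp
  next
    assume "br (v 1) (v 2) = \<alpha> *\<^sub>R v 3 + \<gamma> *\<^sub>R v 4"
    then show ?thesis using iff[of \<gamma> 0] by simp
  qed
qed

end
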